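(* For every $k\ge1$, $$\sum_{n\ge1}\sum_{\substack{\mu\in\mathrm{WComp}_{n-1}\\ \mathrm{supp}(\mu)\subseteq[k]}}\bar\mu_{\Pi_n^k}(\hat0,[n]^\mu)\,\mathbf{x}^\mu\frac{y^n}{n!}=\left[\sum_{n\ge1}h_{n-1}(x_1,\dots,x_k)\frac{y^n}{n!}\right]^{<-1>},$$ where $\bar\mu_{\Pi_n^k}$ is the Möbius function of $\Pi_n^k$, $h_n$ is the complete homogeneous symmetric polynomial, $\mathbf{x}^\mu=x_1^{\mu(1)}\cdots x_k^{\mu(k)}$, and $(\cdot)^{<-1>}$ is compositional inverse in $y$.
   Context: $\mathrm{WComp}_n$ is the set of weak compositions (nonnegative integer sequences) with sum $n$; $\mathrm{supp}(\mu)=\{j:\mu(j)\ne0\}$; addition is componentwise and $\mathbf{e}_r$ is the $r$-th unit vector. $\Pi_n^k$ is the poset of weighted partitions $\{B_1^{\mu_1},\dots,B_t^{\mu_t}\}$ ($\{B_i\}$ a set partition of $[n]$, $\mu_i\in\mathrm{WComp}_{|B_i|-1}$ with support in $[k]$), whose cover relations merge two blocks $A^{a},B^{b}$ into $(A\cup B)^{a+b+\mathbf{e}_r}$ for some $r\in[k]$, other blocks unchanged. Its minimum is $\hat0=\{\{1\}^0,\dots,\{n\}^0\}$; $[n]^\mu$ denotes the one-block weighted partition $\{[n]^\mu\}$. *)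

theory Defs
  imports
    "HOL-Library.Poly_Mapping"
    "HOL-Library.Disjoint_Sets"
    "HOL-Computational_Algebra.Formal_Power_Series"
begin

section \<open>The Moebius function of a locally finite poset\<close>

definition locally_finite :: "'a rel \<Rightarrow> bool" where
  "locally_finite r \<longleftrightarrow> (\<forall>x y. finite {z. (x, z) \<in> r \<and> (z, y) \<in> r})"

text \<open>
  A poset is given by its (reflexive) order relation \<open>r\<close>, with ground set \<open>Field r\<close>. The first
  case of the recursion only serves to make the function total; on locally finite posets it is
  the usual definition, see \<open>moebius_refl\<close> and \<open>moebius_less\<close>.
\<close>

function moebius :: "'a rel \<Rightarrow> 'a \<Rightarrow> 'a \<Rightarrow> int" where
  "moebius r x y =
     (if \<not> (Partial_order r \<and> locally_finite r \<and> (x, y) \<in> r) then 0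
      else if x = y then 1
      else - (\<Sum>z\<in>{z. (x, z) \<in> r \<and> (z, y) \<in> r \<and> z \<noteq> y}. moebius r x z))"
  by pat_completeness auto
termination
proof (relation "Wellfounded.measure (\<lambda>(r, x, y). card {z. (x, z) \<in> r \<and> (z, y) \<in> r})")
  fix r :: "'a rel" and x y z
  assume "\<not> \<not> (Partial_order r \<and> locally_finite r \<and> (x, y) \<in> r)"
    and z: "z \<in> {z. (x, z) \<in> r \<and> (z, y) \<in> r \<and> z \<noteq> y}"
  then have po: "Partial_order r" and fin: "locally_finite r" and xy: "(x, y) \<in> r" by auto
  have "trans r" "antisym r" and refl: "(y, y) \<in> r"
    using po xy by (auto simp: partial_order_on_def preorder_on_def refl_on_def Field_def)
  then have "{w. (x, w) \<in> r \<and> (w, z) \<in> r} \<subset> {w. (x, w) \<in> r \<and> (w, y) \<in> r}"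
    using z xy by (auto dest: transD antisymD)
  then show "((r, x, z), (r, x, y)) \<in>
      Wellfounded.measure (\<lambda>(r, x, y). card {z. (x, z) \<in> r \<and> (z, y) \<in> r})"
    using fin by (auto simp: locally_finite_def intro: psubset_card_mono)
qed simp

declare moebius.simps [simp del]

lemma moebius_refl:
  assumes "Partial_order r" "locally_finite r" "x \<in> Field r"
  shows "moebius r x x = 1"
proof -
  have "(x, x) \<in> r"
    using assms by (auto simp: partial_order_on_def preorder_on_def refl_on_def)
  then show ?thesis using assms by (simp add: moebius.simps)
qed

lemma moebius_less:
  assumes "Partial_order r" "locally_finite r" "(x, y) \<in> r" "x \<noteq> y"
  shows "moebius r x y = - (\<Sum>z | (x, z) \<in> r \<and> (z, y) \<in> r \<and> z \<noteq> y. moebius r x z)"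
  using assms by (subst moebius.simps) simp


section \<open>Weak compositions and polynomials\<close>

text \<open>
  A weak composition is a finitely supported function on the positive integers; index \<open>0\<close> is
  excluded. The same type serves as the type of exponents of monomials.
\<close>

definition WComp :: "nat \<Rightarrow> (nat \<Rightarrow>\<^sub>0 nat) set" where
  "WComp n = {\<mu>. 0 \<notin> Poly_Mapping.keys \<mu> \<and> (\<Sum>j\<in>Poly_Mapping.keys \<mu>. Poly_Mapping.lookup \<mu> j) = n}"

definition WComp_in :: "nat \<Rightarrow> nat \<Rightarrow> (nat \<Rightarrow>\<^sub>0 nat) set" where
  "WComp_in k n = {\<mu> \<in> WComp n. Poly_Mapping.keys \<mu> \<subseteq> {1..k}}"

text \<open>Polynomials with rational coefficients in the variables \<open>x\<^sub>1, x\<^sub>2, \<dots>\<close>.\<close>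

type_synonym mpoly = "(nat \<Rightarrow>\<^sub>0 nat) \<Rightarrow>\<^sub>0 rat"

definition Const :: "rat \<Rightarrow> mpoly" where
  "Const c = Poly_Mapping.single 0 c"

definition Var :: "nat \<Rightarrow> mpoly" where
  "Var i = Poly_Mapping.single (Poly_Mapping.single i 1) 1"

definition xpow :: "nat \<Rightarrow> (nat \<Rightarrow>\<^sub>0 nat) \<Rightarrow> mpoly" where
  "xpow k \<mu> = (\<Prod>i\<in>{1..k}. Var i ^ Poly_Mapping.lookup \<mu> i)"

text \<open>The sum of all monomials of degree \<open>n\<close> in \<open>x\<^sub>1, \<dots>, x\<^sub>k\<close>.\<close>

definition complete_homogeneous :: "nat \<Rightarrow> nat \<Rightarrow> mpoly" where
  "complete_homogeneous k n = (\<Sum>\<mu>\<in>WComp_in k n. xpow k \<mu>)"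


section \<open>Weighted partitions\<close>

text \<open>A weighted block \<open>B\<^sup>\<mu>\<close> is the pair \<open>(B, \<mu>)\<close>.\<close>

type_synonym weighted_partition = "(nat set \<times> (nat \<Rightarrow>\<^sub>0 nat)) set"

definition weighted_partitions :: "nat \<Rightarrow> nat \<Rightarrow> weighted_partition set" where
  "weighted_partitions n k =
     {P. partition_on {1..n} (fst ` P) \<and> inj_on fst P \<and>
         (\<forall>(B, \<mu>)\<in>P. \<mu> \<in> WComp_in k (card B - 1))}"

definition merge :: "nat \<Rightarrow> weighted_partition \<Rightarrow> weighted_partition \<Rightarrow> bool" where
  "merge k P Q \<longleftrightarrow>
     (\<exists>A a B b r. (A, a) \<in> P \<and> (B, b) \<in> P \<and> A \<noteq> B \<and> r \<in> {1..k} \<and>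
        Q = P - {(A, a), (B, b)} \<union> {(A \<union> B, a + b + Poly_Mapping.single r 1)})"

text \<open>
  Merging stays inside \<open>weighted_partitions n k\<close> and lowers the number of blocks by one, so the
  cover relation of the reflexive-transitive closure below is exactly \<open>merge k\<close>.
\<close>

definition Pi_poset :: "nat \<Rightarrow> nat \<Rightarrow> weighted_partition rel" where
  "Pi_poset n k =
     {(P, Q). P \<in> weighted_partitions n k \<and> Q \<in> weighted_partitions n k \<and> (merge k)\<^sup>*\<^sup>* P Q}"

definition Pi_bot :: "nat \<Rightarrow> weighted_partition" where
  "Pi_bot n = (\<lambda>i. ({i}, 0)) ` {1..n}"

definition one_block :: "nat \<Rightarrow> (nat \<Rightarrow>\<^sub>0 nat) \<Rightarrow> weighted_partition" where
  "one_block n \<mu> = {({1..n}, \<mu>)}"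


section \<open>Compositional inverses\<close>

text \<open>
  The library's \<open>fps_inv\<close> requires coefficients in a field, whereas here they lie in a polynomial
  ring. A two-sided inverse with respect to composition is unique.
\<close>

definition is_compositional_inverse :: "'a::comm_ring_1 fps \<Rightarrow> 'a fps \<Rightarrow> bool" where
  "is_compositional_inverse g f \<longleftrightarrow>
     fps_nth f 0 = 0 \<and> fps_nth g 0 = 0 \<and> f oo g = fps_X \<and> g oo f = fps_X"


section \<open>Basic properties\<close>

lemma finite_WComp_in: "finite (WComp_in k n)"
proof -
  have "Poly_Mapping.lookup ` WComp_in k n \<subseteq> {f. \<forall>i. (i \<in> {1..k} \<longrightarrow> f i \<in> {..n}) \<and> (i \<notin> {1..k} \<longrightarrow> f i = 0)}"
  proof (rule image_subsetI)
    fix \<mu>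
    assume \<mu>: "\<mu> \<in> WComp_in k n"
    then have n: "(\<Sum>j\<in>Poly_Mapping.keys \<mu>. Poly_Mapping.lookup \<mu> j) = n"
      and k: "Poly_Mapping.keys \<mu> \<subseteq> {1..k}"
      by (auto simp: WComp_in_def WComp_def)
    have "Poly_Mapping.lookup \<mu> i \<in> {..n}" for i
    proof (cases "i \<in> Poly_Mapping.keys \<mu>")
      case True
      then show ?thesis
        using member_le_sum[of i "Poly_Mapping.keys \<mu>" "Poly_Mapping.lookup \<mu>"] n by simp
    qed (simp add: in_keys_iff)
    moreover have "Poly_Mapping.lookup \<mu> i = 0" if "i \<notin> {1..k}" for i
      using k that by (metis in_keys_iff subsetD)
    ultimately show "Poly_Mapping.lookup \<mu> \<in>
        {f. \<forall>i. (i \<in> {1..k} \<longrightarrow> f i \<in> {..n}) \<and> (i \<notin> {1..k} \<longrightarrow> f i = 0)}"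
      by blast
  qed
  moreover have "finite {f :: nat \<Rightarrow> nat. \<forall>i. (i \<in> {1..k} \<longrightarrow> f i \<in> {..n}) \<and> (i \<notin> {1..k} \<longrightarrow> f i = 0)}"
    by (rule finite_set_of_finite_funs) auto
  ultimately have "finite (Poly_Mapping.lookup ` WComp_in k n)"
    by (rule finite_subset)
  then show ?thesis
    by (rule finite_imageD) (auto simp: inj_on_def intro: poly_mapping_eqI)
qed

lemma weighted_partitions_subset:
  "weighted_partitions n k \<subseteq> Pow (Pow {1..n} \<times> (\<Union>m\<le>n. WComp_in k m))"
proof
  fix P assume P: "P \<in> weighted_partitions n k"
  have "B \<subseteq> {1..n} \<and> \<mu> \<in> WComp_in k (card B - 1) \<and> card B - 1 \<le> n" if "(B, \<mu>) \<in> P" for B \<mu>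
  proof -
    have B: "B \<subseteq> {1..n}"
      using P that by (force simp: weighted_partitions_def partition_on_def)
    then have "card B \<le> n"
      using card_mono[of "{1..n}" B] by simp
    with B P that show ?thesis by (auto simp: weighted_partitions_def)
  qed
  then show "P \<in> Pow (Pow {1..n} \<times> (\<Union>m\<le>n. WComp_in k m))" by fast
qed

lemma finite_weighted_partitions: "finite (weighted_partitions n k)"
  using weighted_partitions_subset by (rule finite_subset) (simp add: finite_WComp_in)

lemma finite_weighted_partition:
  assumes "P \<in> weighted_partitions n k"
  shows "finite P"
proof (rule finite_subset)
  show "P \<subseteq> Pow {1..n} \<times> (\<Union>m\<le>n. WComp_in k m)"
    using subsetD[OF weighted_partitions_subset assms] by (rule PowD)
  show "finite (Pow {1..n} \<times> (\<Union>m\<le>n. WComp_in k m))"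
    by (simp add: finite_WComp_in)
qed

lemma sum_lookup_add:
  "(\<Sum>j\<in>Poly_Mapping.keys (a + b). Poly_Mapping.lookup (a + b) j) =
   (\<Sum>j\<in>Poly_Mapping.keys a. Poly_Mapping.lookup a j) + (\<Sum>j\<in>Poly_Mapping.keys b. Poly_Mapping.lookup b j)" for a b :: "nat \<Rightarrow>\<^sub>0 nat"
proof -
  let ?S = "Poly_Mapping.keys a \<union> Poly_Mapping.keys b"
  have S: "(\<Sum>j\<in>Poly_Mapping.keys c. Poly_Mapping.lookup c j) = (\<Sum>j\<in>?S. Poly_Mapping.lookup c j)" if "Poly_Mapping.keys c \<subseteq> ?S" for c :: "nat \<Rightarrow>\<^sub>0 nat"
    using that by (intro sum.mono_neutral_left) (auto simp: in_keys_iff)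
  show ?thesis
    using S[of "a + b"] S[of a] S[of b] Poly_Mapping.keys_add[of a b]
    by (simp add: lookup_add sum.distrib)
qed

lemma WComp_in_add:
  assumes "a \<in> WComp_in k m" "b \<in> WComp_in k n"
  shows "a + b \<in> WComp_in k (m + n)"
  using assms Poly_Mapping.keys_add[of a b] by (auto simp: WComp_in_def WComp_def sum_lookup_add)

lemma WComp_in_single: "r \<in> {1..k} \<Longrightarrow> Poly_Mapping.single r 1 \<in> WComp_in k 1"
  by (auto simp: WComp_in_def WComp_def)

lemma merge_card:
  assumes "merge k P Q" "finite P"
  shows "finite Q \<and> card Q < card P"
proof -
  obtain A a B b r where *: "(A, a) \<in> P" "(B, b) \<in> P" "A \<noteq> B"
    "Q = P - {(A, a), (B, b)} \<union> {(A \<union> B, a + b + Poly_Mapping.single r 1)}"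
    using assms unfolding merge_def by blast
  have "card {(A, a), (B, b)} \<le> card P"
    using * assms by (intro card_mono) auto
  moreover have "card (P - {(A, a), (B, b)}) = card P - card {(A, a), (B, b)}"
    using * by (intro card_Diff_subset) auto
  ultimately show ?thesis
    using * assms by (auto simp: card_insert_if)
qed

lemma merge_weighted_partitions:
  assumes P: "P \<in> weighted_partitions n k" and "merge k P Q"
  shows "Q \<in> weighted_partitions n k"
proof -
  obtain A a B b r where ab: "(A, a) \<in> P" "(B, b) \<in> P" "A \<noteq> B" and r: "r \<in> {1..k}"
    and Q: "Q = P - {(A, a), (B, b)} \<union> {(A \<union> B, a + b + Poly_Mapping.single r 1)}"
    using assms unfolding merge_def by blast
  have part: "partition_on {1..n} (fst ` P)" and inj: "inj_on fst P"
    and wt: "\<And>C c. (C, c) \<in> P \<Longrightarrow> c \<in> WComp_in k (card C - 1)"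
    using P by (auto simp: weighted_partitions_def)
  have un: "\<Union> (fst ` P) = {1..n}" and disj: "disjoint (fst ` P)" and ne: "{} \<notin> fst ` P"
    using part by (auto simp: partition_on_def)
  have AB: "A \<in> fst ` P" "B \<in> fst ` P" using ab by force+
  have fin: "finite A" "finite B"
    using AB un finite_subset[of _ "{1..n}"] by blast+
  have ne': "A \<noteq> {}" "B \<noteq> {}" using AB ne by auto
  have dAB: "A \<inter> B = {}" using disj AB ab by (auto simp: disjoint_def)
  have key: "C \<inter> A = {} \<and> C \<inter> B = {}" if "(C, c) \<in> P - {(A, a), (B, b)}" for C c
  proof -
    have "C \<in> fst ` P" using that by force
    moreover have "C \<noteq> A"
      using that ab(1) inj_onD[OF inj, of "(C, c)" "(A, a)"] by auto
    moreover have "C \<noteq> B"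
      using that ab(2) inj_onD[OF inj, of "(C, c)" "(B, b)"] by auto
    ultimately show ?thesis using disj AB by (auto simp: disjoint_def)
  qed
  let ?R = "fst ` (P - {(A, a), (B, b)})"
  have old: "E \<in> fst ` P" "E \<inter> (A \<union> B) = {}" if "E \<in> ?R" for E
  proof -
    obtain e where e: "(E, e) \<in> P - {(A, a), (B, b)}"
      using \<open>E \<in> ?R\<close> by (rule imageE) (metis prod.collapse)
    show "E \<in> fst ` P" using e by (metis DiffD1 fst_conv imageI)
    show "E \<inter> (A \<union> B) = {}" using key[OF e] by (simp add: Int_Un_distrib)
  qed
  have fQ: "fst ` Q = fst ` (P - {(A, a), (B, b)}) \<union> {A \<union> B}" by (simp add: Q)
  have fP: "fst ` P = fst ` (P - {(A, a), (B, b)}) \<union> {A, B}"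
    using ab(1,2) by force
  have "\<Union> (fst ` Q) = \<Union> (fst ` P)"
    unfolding fQ fP Union_Un_distrib by simp
  then have "\<Union> (fst ` Q) = {1..n}"
    using un by simp
  moreover have "disjoint (fst ` Q)"
    unfolding disjoint_def
  proof (intro ballI impI)
    fix C D
    assume CD: "C \<in> fst ` Q" "D \<in> fst ` Q" "C \<noteq> D"
    consider "C \<in> ?R" "D \<in> ?R" | "C = A \<union> B" "D \<in> ?R" | "C \<in> ?R" "D = A \<union> B"
      using CD unfolding fQ by blast
    then show "C \<inter> D = {}"
    proof cases
      case 1
      then show ?thesis
        using disjointD[OF disj old(1)[of C] old(1)[of D]] CD(3) by simp
    next
      case 2
      then show ?thesis using old(2)[of D] by (simp add: Int_commute)
    next
      case 3
      then show ?thesis using old(2)[of C] by simp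
    qed
  qed
  moreover have "{} \<notin> fst ` Q"
    unfolding fQ using ne ne' by auto
  moreover have "inj_on fst Q"
  proof -
    have "A \<union> B \<notin> fst ` (P - {(A, a), (B, b)})"
      using old(2)[of "A \<union> B"] ne' by auto
    then show ?thesis
      unfolding Q using inj by (auto intro: inj_on_diff)
  qed
  moreover have "a + b + Poly_Mapping.single r 1 \<in> WComp_in k (card (A \<union> B) - 1)"
  proof -
    have "card A \<ge> 1" "card B \<ge> 1"
      using fin ne' by (auto simp: Suc_le_eq card_gt_0_iff)
    then have "card (A \<union> B) - 1 = card A - 1 + (card B - 1) + 1"
      using card_Un_disjoint[OF fin dAB] by simp
    then show ?thesis
      using WComp_in_add[OF WComp_in_add[OF wt[OF ab(1)] wt[OF ab(2)]] WComp_in_single[OF r]]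
      by simp
  qed
  then have "\<And>C c. (C, c) \<in> Q \<Longrightarrow> c \<in> WComp_in k (card C - 1)"
    using wt unfolding Q by blast
  ultimately show ?thesis
    unfolding weighted_partitions_def partition_on_def by blast
qed

lemma Field_Pi_poset: "Field (Pi_poset n k) = weighted_partitions n k"
  by (auto simp: Field_def Pi_poset_def)

lemma Partial_order_Pi_poset: "Partial_order (Pi_poset n k)"
proof -
  have le: "finite Q \<and> (P = Q \<or> card Q < card P)" if "(merge k)\<^sup>*\<^sup>* P Q" "finite P" for P Q
    using that by (induction rule: rtranclp_induct) (auto dest: merge_card)
  have "antisym (Pi_poset n k)"
  proof (rule antisymI)
    fix P Q assume "(P, Q) \<in> Pi_poset n k" "(Q, P) \<in> Pi_poset n k"
    then have *: "(merge k)\<^sup>*\<^sup>* P Q" "(merge k)\<^sup>*\<^sup>* Q P" and "finite P" "finite Q"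
      by (auto simp: Pi_poset_def dest: finite_weighted_partition)
    then show "P = Q" using le[OF *(1)] le[OF *(2)] by auto
  qed
  moreover have "trans (Pi_poset n k)"
    unfolding Pi_poset_def trans_def by (blast intro: rtranclp_trans)
  ultimately show ?thesis
    unfolding partial_order_on_def preorder_on_def refl_on_def Field_Pi_poset
    by (auto simp: Pi_poset_def)
qed

lemma locally_finite_Pi_poset: "locally_finite (Pi_poset n k)"
  unfolding locally_finite_def
proof (intro allI)
  fix P Q
  have "{R. (P, R) \<in> Pi_poset n k \<and> (R, Q) \<in> Pi_poset n k} \<subseteq> weighted_partitions n k"
    by (auto simp: Pi_poset_def)
  then show "finite {R. (P, R) \<in> Pi_poset n k \<and> (R, Q) \<in> Pi_poset n k}"
    using finite_weighted_partitions by (rule finite_subset)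
qed

lemma Pi_bot_in: "Pi_bot n \<in> weighted_partitions n k"
  by (auto simp: weighted_partitions_def Pi_bot_def partition_on_def disjoint_def inj_on_def
      WComp_in_def WComp_def)

lemma one_block_in:
  assumes "n \<ge> 1" "\<mu> \<in> WComp_in k (n - 1)"
  shows "one_block n \<mu> \<in> weighted_partitions n k"
  using assms by (auto simp: weighted_partitions_def one_block_def partition_on_def)

end

theory Submission
  imports Defs
begin

text \<open>
  Let \<open>G\<close> be the compositional inverse of \<open>H = \<Sum> h\<^bsub>n-1\<^esub> y\<^sup>n / n!\<close>, and let \<open>c(n, \<mu>)\<close> be the coefficient
  of \<open>x\<^sup>\<mu> y\<^sup>n / n!\<close> in \<open>G\<close>. A weighted partition of \<open>B\<close> with \<open>t\<close> blocks and total weight \<open>\<sigma>\<close> lies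
  below \<open>B\<^sup>\<mu>\<close> iff \<open>\<mu> = \<sigma> + \<nu>\<close> with \<open>\<nu>\<close> a weak composition of \<open>t - 1\<close>, so by the exponential formula
  the sum of \<open>\<Prod> c(|A|, \<alpha>)\<close> over all \<open>{A\<^sup>\<alpha>, \<dots>} \<le> B\<^sup>\<mu>\<close> is the coefficient of \<open>x\<^sup>\<mu> y\<^sup>m / m!\<close>, \<open>m = |B|\<close>,
  in \<open>H \<circ> G = y\<close>. The elements below an arbitrary weighted partition \<open>Q\<close> are obtained by choosing
  one such refinement for every block of \<open>Q\<close> independently, so the sum of these products over all
  \<open>P \<le> Q\<close> is \<open>1\<close> for the minimum and \<open>0\<close> otherwise. As this recursion determines the Moebius
  function, its value at \<open>Q\<close> is the product of the \<open>c(|B|, \<mu>)\<close> over the blocks of \<open>Q\<close>.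
\<close>

unbundle fps_syntax

subsection \<open>Compositional inverses over a commutative ring\<close>

text \<open>For \<open>H\<close> with constant term 0 and linear coefficient 1,
  \<open>(H ^ n) $ n\<close> is 1, so the coefficient of degree \<open>n\<close> in
  \<open>G oo H = fps_X\<close> can be solved for \<open>G $ n\<close> without division. This is
  what makes the construction available over a polynomial ring.\<close>

fun comp_inv_coeff :: "'a::comm_ring_1 fps \<Rightarrow> nat \<Rightarrow> 'a" where
  "comp_inv_coeff H n = fps_X $ n - (\<Sum>i<n. comp_inv_coeff H i * (H ^ i) $ n)"

declare comp_inv_coeff.simps [simp del]

definition comp_inv :: "'a::comm_ring_1 fps \<Rightarrow> 'a fps" where
  "comp_inv H = Abs_fps (comp_inv_coeff H)"

lemma comp_inv_nth: "comp_inv H $ n = fps_X $ n - (\<Sum>i<n. comp_inv H $ i * (H ^ i) $ n)"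
  unfolding comp_inv_def fps_nth_Abs_fps by (rule comp_inv_coeff.simps)

lemma comp_inv_0: "comp_inv H $ 0 = 0"
  by (subst comp_inv_nth) simp

lemma comp_inv_1: "comp_inv H $ 1 = 1"
  by (subst comp_inv_nth) (simp add: comp_inv_0)

lemma comp_inv_compose:
  assumes "H $ 0 = 0" "H $ 1 = 1"
  shows "comp_inv H oo H = fps_X"
proof (rule fps_ext)
  fix n
  have "{0..n} = insert n {..<n}" for n :: nat by auto
  then have "(comp_inv H oo H) $ n =
      comp_inv H $ n * (H ^ n) $ n + (\<Sum>i<n. comp_inv H $ i * (H ^ i) $ n)"
    by (simp add: fps_compose_nth)
  also have "(H ^ n) $ n = 1"
    using assms by (simp add: startsby_zero_power_nth_same)
  finally show "(comp_inv H oo H) $ n = fps_X $ n"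
    by (subst (asm) comp_inv_nth[of H n]) simp
qed

text \<open>The left inverse \<open>G\<close> of \<open>H\<close> has a left inverse \<open>K\<close> of its own, and
  \<open>K = K \<circ> (G \<circ> H) = (K \<circ> G) \<circ> H = H\<close>.\<close>

lemma compose_comp_inv:
  fixes H :: "'a::idom fps"
  assumes "H $ 0 = 0" "H $ 1 = 1"
  shows "H oo comp_inv H = fps_X"
proof -
  let ?G = "comp_inv H" and ?K = "comp_inv (comp_inv H)"
  have KG: "?K oo ?G = fps_X"
    by (rule comp_inv_compose) (simp_all add: comp_inv_0 comp_inv_1[simplified])
  have "?K = ?K oo (?G oo H)"
    by (simp add: comp_inv_compose[OF assms])
  also have "\<dots> = (?K oo ?G) oo H"
    by (rule fps_compose_assoc) (simp_all add: assms comp_inv_0)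
  also have "\<dots> = H"
    by (simp add: KG assms)
  finally show ?thesis
    using KG by simp
qed


subsection \<open>Homogeneous polynomials\<close>

text \<open>Using \<open>WComp_in k d\<close> also confines the monomials to the variables with
  index in \<open>{1..k}\<close>. The zero polynomial counts as homogeneous of every degree.\<close>

definition homogeneous :: "nat \<Rightarrow> nat \<Rightarrow> mpoly \<Rightarrow> bool" where
  "homogeneous k d p \<longleftrightarrow> Poly_Mapping.keys p \<subseteq> WComp_in k d"

lemma zero_WComp_in: "0 \<in> WComp_in k 0"
  by (auto simp: WComp_in_def WComp_def)

lemma homogeneous_0 [simp]: "homogeneous k d 0"
  by (simp add: homogeneous_def)

lemma homogeneous_1 [simp]: "homogeneous k 0 1"
  by (simp add: homogeneous_def zero_WComp_in)

lemma homogeneous_Const: "homogeneous k 0 (Const c)"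
  by (simp add: homogeneous_def Const_def zero_WComp_in)

lemma homogeneous_diff: "homogeneous k d p \<Longrightarrow> homogeneous k d q \<Longrightarrow> homogeneous k d (p - q)"
  unfolding homogeneous_def using keys_diff[of p q] by blast

lemma homogeneous_sum: "(\<And>i. i \<in> I \<Longrightarrow> homogeneous k d (p i)) \<Longrightarrow> homogeneous k d (\<Sum>i\<in>I. p i)"
  unfolding homogeneous_def using keys_sum[of p I] by blast

lemma homogeneous_mult:
  "homogeneous k d p \<Longrightarrow> homogeneous k e q \<Longrightarrow> homogeneous k (d + e) (p * q)"
  unfolding homogeneous_def using keys_mult[of p q] WComp_in_add by blast

text \<open>Degree in \<open>y\<close> minus degree in \<open>x\<close> is 1 throughout
  \<open>H\<close>, hence \<open>i\<close> throughout \<open>H ^ i\<close>.\<close>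

lemma homogeneous_fps_power:
  assumes "H $ 0 = 0" "\<And>n. homogeneous k (n - 1) (H $ n)"
  shows "homogeneous k (n - i) ((H ^ i) $ n)"
proof (induction i arbitrary: n)
  case (Suc i)
  have "homogeneous k (n - Suc i) (H $ j * (H ^ i) $ (n - j))" if "j \<in> {0..n}" for j
  \<comment> \<open>Here one of the two factors vanishes; in the other case all the truncated
    subtractions are exact.\<close>
  proof (cases "j = 0 \<or> n - j < i")
    case True
    then show ?thesis
      using assms(1) by (auto simp: startsby_zero_power_prefix)
  next
    case False
    then have "n - Suc i = (j - 1) + (n - j - i)" using that by auto
    then show ?thesis
      using homogeneous_mult assms(2) Suc.IH by metis
  qed
  then show ?case
    by (auto simp: fps_mult_nth intro: homogeneous_sum)
qed simp

text \<open>The degrees add up along the recursion of \<open>comp_inv\<close>: a summand with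
  \<open>0 < i < n\<close> has degree \<open>(i - 1) + (n - i) = n - 1\<close>.\<close>

lemma homogeneous_comp_inv:
  assumes "H $ 0 = 0" "\<And>n. homogeneous k (n - 1) (H $ n)"
  shows "homogeneous k (n - 1) (comp_inv H $ n)"
proof (induction n rule: less_induct)
  case (less n)
  have "homogeneous k (n - 1) (comp_inv H $ i * (H ^ i) $ n)" if "i < n" for i
  proof (cases "i = 0")
    case False
    then have "n - 1 = (i - 1) + (n - i)" using that by auto
    then show ?thesis
      using homogeneous_mult[OF less[OF that] homogeneous_fps_power[OF assms]] by metis
  qed (simp add: comp_inv_0)
  moreover have "homogeneous k (n - 1) (fps_X $ n)"
    by (cases "n = 1") simp_all
  ultimately show ?case
    unfolding comp_inv_nth[of H n] by (intro homogeneous_diff homogeneous_sum) auto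
qed

text \<open>Turns the product of powers into a single basis element, so that coefficients can be
  compared with \<open>lookup\<close>. No variable is lost because the keys lie in
  \<open>{1..k}\<close>.\<close>

lemma xpow_eq_single:
  assumes "\<mu> \<in> WComp_in k n"
  shows "xpow k \<mu> = Poly_Mapping.single \<mu> 1"
proof -
  have pow: "Var i ^ m = Poly_Mapping.single (Poly_Mapping.single i m) 1" for i m
    by (induction m) (simp_all add: Var_def mult_single single_add[symmetric])
  have prod: "(\<Prod>i\<in>I. Poly_Mapping.single (f i) 1) = (Poly_Mapping.single (\<Sum>i\<in>I. f i) 1 :: mpoly)"
    if "finite I" for I :: "nat set" and f
    using that by (induction I) (simp_all add: mult_single)
  have "(\<Sum>i\<in>{1..k}. Poly_Mapping.single i (Poly_Mapping.lookup \<mu> i)) = \<mu>"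
  proof (rule poly_mapping_eqI)
    fix j
    have "Poly_Mapping.lookup \<mu> j = 0" if "j \<notin> {1..k}"
      using assms that by (auto simp: WComp_in_def in_keys_iff)
    then show "Poly_Mapping.lookup (\<Sum>i\<in>{1..k}. Poly_Mapping.single i (Poly_Mapping.lookup \<mu> i)) j =
        Poly_Mapping.lookup \<mu> j"
      by (simp add: lookup_sum lookup_single when_def)
  qed
  then show ?thesis
    by (simp add: xpow_def pow prod)
qed

lemma homogeneous_expand:
  assumes "homogeneous k d p"
  shows "p = (\<Sum>\<mu>\<in>WComp_in k d. Poly_Mapping.single \<mu> (Poly_Mapping.lookup p \<mu>))"
proof (rule poly_mapping_eqI)
  fix \<nu>
  have "Poly_Mapping.lookup p \<nu> = 0" if "\<nu> \<notin> WComp_in k d"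
    using assms that by (auto simp: homogeneous_def in_keys_iff)
  then show "Poly_Mapping.lookup p \<nu> =
      Poly_Mapping.lookup (\<Sum>\<mu>\<in>WComp_in k d. Poly_Mapping.single \<mu> (Poly_Mapping.lookup p \<mu>)) \<nu>"
    by (simp add: lookup_sum lookup_single when_def finite_WComp_in)
qed

lemma complete_homogeneous_eq:
  "complete_homogeneous k n = (\<Sum>\<mu>\<in>WComp_in k n. Poly_Mapping.single \<mu> 1)"
  unfolding complete_homogeneous_def by (intro sum.cong) (simp_all add: xpow_eq_single)

lemma homogeneous_complete_homogeneous: "homogeneous k n (complete_homogeneous k n)"
  unfolding complete_homogeneous_eq by (rule homogeneous_sum) (simp add: homogeneous_def)

lemma WComp_in_0 [simp]: "WComp_in k 0 = {0}"
proof -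
  have "\<mu> = 0" if "\<mu> \<in> WComp_in k 0" for \<mu>
    using that by (auto simp: WComp_in_def WComp_def in_keys_iff intro!: poly_mapping_eqI)
  then show ?thesis using zero_WComp_in by auto
qed

lemma complete_homogeneous_0 [simp]: "complete_homogeneous k 0 = 1"
  by (simp add: complete_homogeneous_eq)

lemma Const_1 [simp]: "Const 1 = 1"
  by (simp add: Const_def)

lemma fact_times_Const: "fact n * Const (1 / fact n) = 1"
proof -
  have "(fact n :: mpoly) = Poly_Mapping.single 0 (fact n)"
    by (metis of_nat_fact single_of_nat)
  then show ?thesis
    by (simp add: Const_def mult_single)
qed


subsection \<open>Weighted partitions of an arbitrary set\<close>

text \<open>The ground set is arbitrary because blocks of a partition, and complements of blocks,
  are partitioned again. One pairwise condition on weighted blocks covers both disjointness and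
  injectivity of \<open>fst\<close>.\<close>

definition wpart :: "nat \<Rightarrow> nat set \<Rightarrow> weighted_partition set" where
  "wpart k S = {P. \<Union> (fst ` P) = S \<and> (\<forall>p\<in>P. fst p \<noteq> {} \<and> snd p \<in> WComp_in k (card (fst p) - 1)) \<and>
     (\<forall>p\<in>P. \<forall>q\<in>P. p \<noteq> q \<longrightarrow> fst p \<inter> fst q = {})}"

lemma weighted_partitions_eq_wpart: "weighted_partitions n k = wpart k {1..n}"
proof (rule set_eqI)
  fix P :: weighted_partition
  have "disjoint (fst ` P) \<and> inj_on fst P \<longleftrightarrow> (\<forall>p\<in>P. \<forall>q\<in>P. p \<noteq> q \<longrightarrow> fst p \<inter> fst q = {})"
    (is "?L \<longleftrightarrow> ?R") if ne: "\<forall>p\<in>P. fst p \<noteq> {}"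
  proof
    assume L: ?L
    show ?R
    proof (intro ballI impI)
      fix p q assume "p \<in> P" "q \<in> P" "p \<noteq> q"
      then show "fst p \<inter> fst q = {}"
        using L disjointD[of "fst ` P" "fst p" "fst q"] inj_onD[of fst P p q] by blast
    qed
  next
    assume R: ?R
    \<comment> \<open>Two distinct weighted blocks with the same underlying set would make that set
      disjoint from itself, hence empty.\<close>
    then have "p = q" if "p \<in> P" "q \<in> P" "fst p = fst q" for p q
      using ne that by (metis Int_absorb)
    then show ?L
      using R unfolding disjoint_def inj_on_def by fastforce
  qed
  moreover have "{} \<notin> fst ` P \<longleftrightarrow> (\<forall>p\<in>P. fst p \<noteq> {})"
    by auto
  ultimately show "P \<in> weighted_partitions n k \<longleftrightarrow> P \<in> wpart k {1..n}"
    unfolding weighted_partitions_def wpart_def partition_on_def mem_Collect_eq case_prod_beta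
      ball_conj_distrib by argo
qed

lemma wpartD:
  assumes "P \<in> wpart k S"
  shows "\<Union> (fst ` P) = S"
    and "p \<in> P \<Longrightarrow> fst p \<noteq> {}"
    and "p \<in> P \<Longrightarrow> snd p \<in> WComp_in k (card (fst p) - 1)"
    and "p \<in> P \<Longrightarrow> q \<in> P \<Longrightarrow> i \<in> fst p \<Longrightarrow> i \<in> fst q \<Longrightarrow> p = q"
  using assms by (auto simp: wpart_def)

lemma finite_wpart:
  assumes "finite S"
  shows "finite (wpart k S)"
proof (rule finite_subset)
  show "wpart k S \<subseteq> Pow (Pow S \<times> (\<Union>m\<le>card S. WComp_in k m))"
  proof (intro subsetI PowI)
    fix P p assume P: "P \<in> wpart k S" and p: "p \<in> P"
    have "fst p \<subseteq> S" using wpartD(1)[OF P] p by auto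
    moreover from this have "card (fst p) - 1 \<le> card S"
      using card_mono[OF assms] by (metis diff_le_self le_trans)
    ultimately show "p \<in> Pow S \<times> (\<Union>m\<le>card S. WComp_in k m)"
      using wpartD(3)[OF P p] by (auto simp: mem_Times_iff)
  qed
  show "finite (Pow (Pow S \<times> (\<Union>m\<le>card S. WComp_in k m)))"
    using assms by (simp add: finite_WComp_in)
qed

lemma finite_wpart_member:
  assumes "P \<in> wpart k S" "finite S"
  shows "finite P"
proof (rule inj_on_finite)
  show "inj_on fst P"
  proof (rule inj_onI)
    fix p q assume "p \<in> P" "q \<in> P" "fst p = fst q"
    then show "p = q"
      using wpartD(2,4)[OF assms(1)] by (metis all_not_in_conv)
  qed
  show "fst ` P \<subseteq> Pow S"
    using wpartD(1)[OF assms(1)] by auto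
qed (use assms(2) in simp)

section \<open>Blockwise refinement and its equivalence with the merge order\<close>

definition restr :: "weighted_partition \<Rightarrow> nat set \<Rightarrow> weighted_partition" where
  "restr P B = {p \<in> P. fst p \<subseteq> B}"

text \<open>The weighted partitions of \<open>B\<close> that lie below the one-block partition \<open>B\<^sup>\<mu>\<close>: merging \<open>t\<close>
  blocks into one takes \<open>t - 1\<close> steps, and \<open>\<nu>\<close> records the indices used.\<close>

definition below :: "nat \<Rightarrow> nat set \<times> (nat \<Rightarrow>\<^sub>0 nat) \<Rightarrow> weighted_partition set" where
  "below k x = {R \<in> wpart k (fst x). \<exists>\<nu>\<in>WComp_in k (card R - 1). snd x = (\<Sum>p\<in>R. snd p) + \<nu>}"

text \<open>A description of the order without chains of merges. Membership in \<open>below\<close>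
  includes that the blocks of \<open>P\<close> inside \<open>fst x\<close> cover
  \<open>fst x\<close>.\<close>

definition refines :: "nat \<Rightarrow> weighted_partition \<Rightarrow> weighted_partition \<Rightarrow> bool" where
  "refines k P Q \<longleftrightarrow> (\<forall>x\<in>Q. restr P (fst x) \<in> below k x)"

lemma restr_wpart:
  assumes "P \<in> wpart k S" "B \<subseteq> \<Union> (fst ` restr P B)"
  shows "restr P B \<in> wpart k B"
  using assms unfolding wpart_def restr_def by auto

lemma restr_self:
  assumes "P \<in> wpart k S" "x \<in> P"
  shows "restr P (fst x) = {x}"
  using wpartD(2,4)[OF assms(1)] assms(2) unfolding restr_def by blast

lemma singleton_below:
  assumes "fst x \<noteq> {}" "snd x \<in> WComp_in k (card (fst x) - 1)"
  shows "{x} \<in> below k x"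
  using assms by (auto simp: below_def wpart_def)

lemma refines_refl:
  assumes "P \<in> wpart k S"
  shows "refines k P P"
  unfolding refines_def
  using restr_self[OF assms] singleton_below wpartD(2,3)[OF assms] by metis

text \<open>A block of \<open>P\<close> meeting \<open>A\<close> shares a point with some block
  inside \<open>A\<close>, since these cover \<open>A\<close>, and so equals it; likewise for
  \<open>B\<close>. Thus no block straddles the two sets.\<close>

lemma restr_Un:
  assumes P: "P \<in> wpart k S" and "restr P A \<in> wpart k A" "restr P B \<in> wpart k B"
  shows "restr P (A \<union> B) = restr P A \<union> restr P B"
proof
  show "restr P (A \<union> B) \<subseteq> restr P A \<union> restr P B"
  proof
    fix p assume "p \<in> restr P (A \<union> B)"
    then have p: "p \<in> P" "fst p \<subseteq> A \<union> B" by (auto simp: restr_def)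
    then obtain i where i: "i \<in> fst p" using wpartD(2)[OF P] by blast
    then obtain q where "q \<in> restr P A \<union> restr P B" "i \<in> fst q"
      using p(2) wpartD(1)[OF assms(2)] wpartD(1)[OF assms(3)] by blast
    moreover from this have "p = q"
      using wpartD(4)[OF P p(1) _ i] unfolding restr_def by blast
    ultimately show "p \<in> restr P A \<union> restr P B" by simp
  qed
qed (auto simp: restr_def)

text \<open>If the two merged blocks contain \<open>t\<close> and \<open>t'\<close> blocks of
  \<open>P\<close>, their witnesses have sizes \<open>t - 1\<close> and \<open>t' - 1\<close>.
  Adding the unit vector of the merge gives the required size \<open>t + t' - 1\<close>.\<close>

lemma refines_merge:
  assumes P: "P \<in> wpart k S" and Q: "Q \<in> wpart k S" and S: "finite S"
    and PQ: "refines k P Q" and "merge k Q Q'"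
  shows "refines k P Q'"
proof -
  obtain A a B b r where ab: "(A, a) \<in> Q" "(B, b) \<in> Q" "A \<noteq> B" and r: "r \<in> {1..k}"
    and Q': "Q' = Q - {(A, a), (B, b)} \<union> {(A \<union> B, a + b + Poly_Mapping.single r 1)}"
    using assms unfolding merge_def by blast
  let ?R = "restr P A" and ?R' = "restr P B"
  have R: "?R \<in> below k (A, a)" "?R' \<in> below k (B, b)"
    using PQ ab by (auto simp: refines_def)
  then have w: "?R \<in> wpart k A" "?R' \<in> wpart k B"
    by (auto simp: below_def)
  have AB: "A \<inter> B = {}" "A \<noteq> {}" "B \<noteq> {}"
    using wpartD(2,4)[OF Q] ab by fastforce+
  have eq: "restr P (A \<union> B) = ?R \<union> ?R'"
    using restr_Un[OF P w] .
  have dis: "?R \<inter> ?R' = {}"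
    using AB wpartD(2)[OF w(1)] unfolding restr_def by fastforce
  have fin: "finite ?R" "finite ?R'"
    using finite_wpart_member[OF P S] by (auto simp: restr_def)
  have ne: "?R \<noteq> {}" "?R' \<noteq> {}"
    using AB wpartD(1)[OF w(1)] wpartD(1)[OF w(2)] by auto
  then have card: "card (?R \<union> ?R') - 1 = (card ?R - 1) + (card ?R' - 1) + 1"
    using fin card_Un_disjoint[OF fin dis] card_gt_0_iff[of ?R] card_gt_0_iff[of ?R'] by linarith
  obtain \<nu> \<nu>' where nu: "\<nu> \<in> WComp_in k (card ?R - 1)" "\<nu>' \<in> WComp_in k (card ?R' - 1)"
    and s: "a = (\<Sum>p\<in>?R. snd p) + \<nu>" "b = (\<Sum>p\<in>?R'. snd p) + \<nu>'"
    using R by (auto simp: below_def)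
  have "restr P (A \<union> B) \<in> below k (A \<union> B, a + b + Poly_Mapping.single r 1)"
  proof -
    have "restr P (A \<union> B) \<in> wpart k (A \<union> B)"
      using wpartD(1)[OF w(1)] wpartD(1)[OF w(2)] by (intro restr_wpart[OF P]) (auto simp: eq)
    moreover have "\<nu> + \<nu>' + Poly_Mapping.single r 1 \<in> WComp_in k (card (restr P (A \<union> B)) - 1)"
      unfolding eq card by (intro WComp_in_add nu WComp_in_single r)
    moreover have "a + b + Poly_Mapping.single r 1 =
        (\<Sum>p\<in>restr P (A \<union> B). snd p) + (\<nu> + \<nu>' + Poly_Mapping.single r 1)"
      unfolding eq sum.union_disjoint[OF fin dis] s by (simp add: algebra_simps)
    ultimately show ?thesis
      unfolding below_def by auto
  qed
  then show ?thesis
    using PQ unfolding refines_def Q' by auto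
qed

lemma WComp_in_Suc_split:
  assumes "\<nu> \<in> WComp_in k (Suc m)"
  obtains r \<nu>' where "r \<in> {1..k}" "\<nu>' \<in> WComp_in k m" "\<nu> = \<nu>' + Poly_Mapping.single r 1"
proof -
  have "Poly_Mapping.keys \<nu> \<noteq> {}"
    using assms by (auto simp: WComp_in_def WComp_def)
  then obtain r where r: "r \<in> Poly_Mapping.keys \<nu>" by blast
  then have rk: "r \<in> {1..k}" using assms by (auto simp: WComp_in_def)
  \<comment> \<open>Subtraction of exponents is truncated; it is exact here because \<open>r\<close>
    is a key of \<nu>.\<close>
  let ?\<nu>' = "\<nu> - Poly_Mapping.single r 1"
  have eq: "\<nu> = ?\<nu>' + Poly_Mapping.single r 1"
    using r by (intro poly_mapping_eqI) (auto simp: lookup_add lookup_minus lookup_single when_def in_keys_iff)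
  have "Poly_Mapping.keys ?\<nu>' \<subseteq> Poly_Mapping.keys \<nu>"
    by (auto simp: in_keys_iff lookup_minus)
  moreover have "(\<Sum>j\<in>Poly_Mapping.keys \<nu>. Poly_Mapping.lookup \<nu> j) =
      (\<Sum>j\<in>Poly_Mapping.keys ?\<nu>'. Poly_Mapping.lookup ?\<nu>' j) + 1"
    using sum_lookup_add[of ?\<nu>' "Poly_Mapping.single r 1"] unfolding eq[symmetric] by simp
  ultimately have "?\<nu>' \<in> WComp_in k m"
    using assms by (auto simp: WComp_in_def WComp_def)
  then show ?thesis using that rk eq by blast
qed

lemma refines_subset_blocks:
  assumes "P \<in> wpart k S" "Q \<in> wpart k S" "refines k P Q" "p \<in> P"
  shows "\<exists>x\<in>Q. p \<in> restr P (fst x)"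
proof -
  obtain i where i: "i \<in> fst p" "i \<in> S"
    using wpartD(1,2)[OF assms(1)] assms(4) by blast
  then obtain x where x: "x \<in> Q" "i \<in> fst x"
    using wpartD(1)[OF assms(2)] by blast
  then have "restr P (fst x) \<in> wpart k (fst x)"
    using assms(3) by (auto simp: refines_def below_def)
  from wpartD(1)[OF this] obtain q where "q \<in> restr P (fst x)" "i \<in> fst q"
    using x by blast
  then show ?thesis
    using wpartD(4)[OF assms(1,4) _ i(1)] x unfolding restr_def by blast
qed

text \<open>Some block \<open>x\<close> of \<open>Q\<close> is split in \<open>P\<close>. Any two of
  its parts may be merged with an index \<open>r\<close> taken off the witness \<nu>, and what
  remains of \<nu> is the witness for the new partition.\<close>

lemma refines_merge_step:
  assumes P: "P \<in> weighted_partitions n k" and Q: "Q \<in> weighted_partitions n k"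
    and PQ: "refines k P Q" and "P \<noteq> Q"
  obtains P' where "merge k P P'" "refines k P' Q"
proof -
  note P = P[unfolded weighted_partitions_eq_wpart] and Q = Q[unfolded weighted_partitions_eq_wpart]
    and P0 = P
  have finP: "finite P" using finite_wpart_member[OF P] by simp
  obtain x where x: "x \<in> Q" "restr P (fst x) \<noteq> {x}"
  proof (rule ccontr)
    assume "\<not> thesis"
    then have *: "restr P (fst x) = {x}" if "x \<in> Q" for x
      using that \<open>\<And>x. x \<in> Q \<Longrightarrow> restr P (fst x) \<noteq> {x} \<Longrightarrow> thesis\<close> by blast
    then have "P \<subseteq> Q" using refines_subset_blocks[OF P Q PQ] by fastforce
    moreover have "Q \<subseteq> P" using * by (auto simp: restr_def)
    ultimately show False using \<open>P \<noteq> Q\<close> by blast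
  qed
  let ?R = "restr P (fst x)"
  have R: "?R \<in> wpart k (fst x)" and "\<exists>\<nu>\<in>WComp_in k (card ?R - 1). snd x = (\<Sum>p\<in>?R. snd p) + \<nu>"
    using PQ x by (auto simp: refines_def below_def)
  then obtain \<nu> where nu: "\<nu> \<in> WComp_in k (card ?R - 1)" and s: "snd x = (\<Sum>p\<in>?R. snd p) + \<nu>"
    by blast
  have fin: "finite ?R" using finP by (simp add: restr_def)
  have "?R \<noteq> {}" using wpartD(1)[OF R] wpartD(2)[OF Q x(1)] by auto
  then obtain p where p: "p \<in> ?R" by blast
  \<comment> \<open>A single part would force \<nu> to be 0 and that part to be \<open>x\<close>
    itself, weight included.\<close>
  obtain q where q: "q \<in> ?R" "p \<noteq> q"
  proof (rule ccontr)
    assume "\<not> thesis"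
    then have Rp: "?R = {p}" using p that by blast
    then have "\<nu> = 0" using nu by simp
    with s Rp wpartD(1)[OF R] have "x = p" by (simp add: prod_eq_iff)
    with Rp x show False by simp
  qed
  have pq: "p \<in> P" "q \<in> P" "fst p \<subseteq> fst x" "fst q \<subseteq> fst x" using p q by (auto simp: restr_def)
  \<comment> \<open>So \<nu> has size \<open>Suc (card (?R - {p, q}))\<close>, and a unit vector can
    be split off.\<close>
  have cardpq: "card ?R = card (?R - {p, q}) + 2"
    using p q fin card_Diff_subset[of "{p, q}" ?R] card_mono[of ?R "{p, q}"] by simp
  then obtain r \<nu>' where r: "r \<in> {1..k}" and nu': "\<nu>' \<in> WComp_in k (card (?R - {p, q}))"
    and nu_eq: "\<nu> = \<nu>' + Poly_Mapping.single r 1"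
    using nu WComp_in_Suc_split[of \<nu> k "card (?R - {p, q})"] by auto
  define z where "z = (fst p \<union> fst q, snd p + snd q + Poly_Mapping.single r 1)"
  define P' where "P' = P - {p, q} \<union> {z}"
  have "fst p \<noteq> fst q"
    using wpartD(2,4)[OF P] pq q(2) by blast
  then have merge: "merge k P P'"
    unfolding merge_def P'_def z_def using pq r
    by (intro exI[of _ "fst p"] exI[of _ "snd p"] exI[of _ "fst q"] exI[of _ "snd q"] exI[of _ r]) simp
  have P': "P' \<in> wpart k {1..n}"
    using merge_weighted_partitions[OF _ merge] P by (simp add: weighted_partitions_eq_wpart)
  have ne: "fst p \<noteq> {}" "fst q \<noteq> {}" using wpartD(2)[OF P] pq by auto
  \<comment> \<open>The new block is really new, so it adds exactly one to the cardinality and its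
    weight once to the sum.\<close>
  have z: "z \<notin> P"
  proof
    assume "z \<in> P"
    then have "p = z" "q = z"
      using wpartD(4)[OF P pq(1) \<open>z \<in> P\<close>] wpartD(4)[OF P pq(2) \<open>z \<in> P\<close>] ne by (auto simp: z_def)
    with q show False by simp
  qed
  have "restr P' (fst y) \<in> below k y" if y: "y \<in> Q" for y
  proof (cases "y = x")
    case False
    then have "fst y \<inter> fst x = {}" using wpartD(4)[OF Q y x(1)] by blast
    then have "\<not> fst p \<subseteq> fst y" "\<not> fst q \<subseteq> fst y"
      using pq ne by blast+
    then have "restr P' (fst y) = restr P (fst y)"
      by (auto simp: restr_def P'_def z_def)
    then show ?thesis using PQ y by (auto simp: refines_def)
  next
    case True
    have R': "restr P' (fst x) = ?R - {p, q} \<union> {z}"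
      using pq by (auto simp: restr_def P'_def z_def)
    have Rpq: "?R = ?R - {p, q} \<union> {p, q}" using p q by blast
    have "\<Union> (fst ` ?R) = \<Union> (fst ` (?R - {p, q})) \<union> (fst p \<union> fst q)"
      by (subst Rpq) auto
    then have "restr P' (fst x) \<in> wpart k (fst x)"
      using wpartD(1)[OF R] by (intro restr_wpart[OF P']) (auto simp: R' z_def)
    moreover have "card (restr P' (fst x)) - 1 = card (?R - {p, q})"
      using z fin unfolding R' by (simp add: restr_def)
    then have "\<nu>' \<in> WComp_in k (card (restr P' (fst x)) - 1)"
      using nu' by simp
    moreover have "snd x = (\<Sum>p\<in>restr P' (fst x). snd p) + \<nu>'"
    proof -
      have "(\<Sum>u\<in>?R. snd u) = (\<Sum>u\<in>?R - {p, q}. snd u) + (\<Sum>u\<in>{p, q}. snd u)"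
        using p q fin by (intro sum.subset_diff) auto
      moreover have "(\<Sum>u\<in>restr P' (fst x). snd u) = (\<Sum>u\<in>?R - {p, q}. snd u) + snd z"
        using z fin unfolding R' by (simp add: restr_def add.commute)
      ultimately show ?thesis
        using q(2) unfolding s nu_eq by (simp add: z_def algebra_simps)
    qed
    ultimately show ?thesis
      unfolding below_def True by blast
  qed
  then show ?thesis
    using that[OF merge] by (simp add: refines_def)
qed

text \<open>Left to right, each merge preserves refinement. Right to left, a merge towards
  \<open>Q\<close> exists as long as \<open>P\<close> differs from \<open>Q\<close>, and it lowers
  the number of blocks.\<close>

lemma merge_rtranclp_iff_refines:
  assumes P: "P \<in> weighted_partitions n k" and Q: "Q \<in> weighted_partitions n k"
  shows "(merge k)\<^sup>*\<^sup>* P Q \<longleftrightarrow> refines k P Q"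
proof
  assume "(merge k)\<^sup>*\<^sup>* P Q"
  then have "Q \<in> weighted_partitions n k \<and> refines k P Q"
  proof (induction rule: rtranclp_induct)
    case base
    then show ?case using P refines_refl by (auto simp: weighted_partitions_eq_wpart)
  next
    case (step Q Q')
    then show ?case
      using refines_merge[of P k "{1..n}" Q Q'] P merge_weighted_partitions
      by (auto simp: weighted_partitions_eq_wpart)
  qed
  then show "refines k P Q" ..
next
  assume "refines k P Q"
  then show "(merge k)\<^sup>*\<^sup>* P Q"
    using P
  proof (induction "card P" arbitrary: P rule: less_induct)
    case less
    show ?case
    proof (cases "P = Q")
      case False
      then obtain P' where P': "merge k P P'" "refines k P' Q"
        using refines_merge_step[OF less.prems(2) Q less.prems(1)] by blast
      then have "(merge k)\<^sup>*\<^sup>* P' Q"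
        using less merge_card[OF P'(1)] merge_weighted_partitions[OF _ P'(1)] finite_weighted_partition
        by blast
      then show ?thesis using P'(1) by (rule converse_rtranclp_into_rtranclp[rotated])
    qed simp
  qed
qed

lemma Pi_poset_iff:
  "(P, Q) \<in> Pi_poset n k \<longleftrightarrow> P \<in> wpart k {1..n} \<and> Q \<in> wpart k {1..n} \<and> refines k P Q"
  using merge_rtranclp_iff_refines
  by (auto simp: Pi_poset_def weighted_partitions_eq_wpart)


subsection \<open>Sums over weighted partitions\<close>

text \<open>Expanding the product of sums gives a sum over choice functions in
  \<open>PiE Q (below k)\<close>. Gluing the chosen partitions and restricting to the blocks of
  \<open>Q\<close> are inverse to each other.\<close>

lemma sum_prod_refines:
  fixes g :: "nat set \<times> (nat \<Rightarrow>\<^sub>0 nat) \<Rightarrow> 'a::comm_semiring_1"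
  assumes Q: "Q \<in> wpart k S" and S: "finite S"
  shows "(\<Sum>P | P \<in> wpart k S \<and> refines k P Q. \<Prod>p\<in>P. g p) =
    (\<Prod>x\<in>Q. \<Sum>R\<in>below k x. \<Prod>p\<in>R. g p)"
proof -
  have finQ: "finite Q" using finite_wpart_member[OF Q S] .
  have "finite (fst x)" if "x \<in> Q" for x
    using wpartD(1)[OF Q] that S by (auto intro: finite_subset)
  then have finb: "finite (below k x)" if "x \<in> Q" for x
    using finite_wpart[of "fst x" k] that by (simp add: below_def)
  have blocks: "fst p \<noteq> {} \<and> fst p \<subseteq> fst x" if "p \<in> R" "R \<in> below k x" for p R x
    using that wpartD(1,2)[of R k "fst x"] by (auto simp: below_def)
  \<comment> \<open>Chosen blocks are nonempty and the blocks of \<open>Q\<close> are disjoint, so a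
    chosen block inside \<open>fst y\<close> can only come from \<open>y\<close>.\<close>
  have restr: "restr (\<Union>(\<phi> ` Q)) (fst y) = \<phi> y" if phi: "\<phi> \<in> PiE Q (below k)" and y: "y \<in> Q" for \<phi> y
  proof
    show "restr (\<Union>(\<phi> ` Q)) (fst y) \<subseteq> \<phi> y"
    proof
      fix p assume "p \<in> restr (\<Union>(\<phi> ` Q)) (fst y)"
      then obtain x where x: "x \<in> Q" "p \<in> \<phi> x" "fst p \<subseteq> fst y"
        by (auto simp: restr_def)
      then have "fst p \<noteq> {}" "fst p \<subseteq> fst x"
        using blocks PiE_mem[OF phi x(1)] by blast+
      with x y have "x = y" using wpartD(4)[OF Q] by blast
      with x show "p \<in> \<phi> y" by simp
    qed
    show "\<phi> y \<subseteq> restr (\<Union>(\<phi> ` Q)) (fst y)"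
      using blocks[OF _ PiE_mem[OF phi y]] y unfolding restr_def by blast
  qed
  have union: "(\<Union>x\<in>Q. restr P (fst x)) = P" if "P \<in> wpart k S" "refines k P Q" for P
    using refines_subset_blocks[OF that(1) Q that(2)] by (auto simp: restr_def)
  have glue: "\<Union>(\<phi> ` Q) \<in> wpart k S" if phi: "\<phi> \<in> PiE Q (below k)" for \<phi>
  proof -
    have w: "\<phi> x \<in> wpart k (fst x)" if "x \<in> Q" for x
      using PiE_mem[OF phi that] by (simp add: below_def)
    have "\<Union> (fst ` (\<Union>(\<phi> ` Q))) = (\<Union>x\<in>Q. \<Union> (fst ` \<phi> x))" by blast
    also have "\<dots> = S" using wpartD(1)[OF w] wpartD(1)[OF Q] by simp
    finally have "\<Union> (fst ` (\<Union>(\<phi> ` Q))) = S" .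
    moreover have "fst p \<inter> fst q = {}"
      if p: "p \<in> \<phi> x" "x \<in> Q" and q: "q \<in> \<phi> y" "y \<in> Q" and "p \<noteq> q" for p q x y
    proof (cases "x = y")
      case True
      then show ?thesis using wpartD(4)[OF w[OF p(2)] p(1), of q] q(1) \<open>p \<noteq> q\<close> by blast
    next
      case False
      then have "fst x \<inter> fst y = {}" using wpartD(4)[OF Q p(2) q(2)] by blast
      then show ?thesis
        using blocks[OF p(1) PiE_mem[OF phi p(2)]] blocks[OF q(1) PiE_mem[OF phi q(2)]] by blast
    qed
    ultimately show ?thesis
      using wpartD(2,3)[OF w] unfolding wpart_def by blast
  qed
  have "(\<Prod>x\<in>Q. \<Sum>R\<in>below k x. \<Prod>p\<in>R. g p) = (\<Sum>\<phi>\<in>PiE Q (below k). \<Prod>x\<in>Q. \<Prod>p\<in>\<phi> x. g p)"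
    using finQ finb by (rule prod_sum_PiE)
  also have "\<dots> = (\<Sum>P | P \<in> wpart k S \<and> refines k P Q. \<Prod>p\<in>P. g p)"
  proof (rule sum.reindex_bij_witness[symmetric,
      where i = "\<lambda>\<phi>. \<Union>(\<phi> ` Q)" and j = "\<lambda>P. \<lambda>x\<in>Q. restr P (fst x)"])
    fix P assume "P \<in> {P. P \<in> wpart k S \<and> refines k P Q}"
    then have P: "P \<in> wpart k S" "refines k P Q" by simp_all
    show "\<Union>((\<lambda>x\<in>Q. restr P (fst x)) ` Q) = P" using union[OF P] by simp
    show "(\<lambda>x\<in>Q. restr P (fst x)) \<in> PiE Q (below k)" using P(2) by (simp add: refines_def)
    have "restr P (fst x) \<inter> restr P (fst y) = {}" if "x \<in> Q" "y \<in> Q" "x \<noteq> y" for x y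
      using wpartD(4)[OF Q that(1,2)] wpartD(2)[OF P(1)] that(3) unfolding restr_def by blast
    then have "(\<Prod>p\<in>(\<Union>x\<in>Q. restr P (fst x)). g p) = (\<Prod>x\<in>Q. \<Prod>p\<in>restr P (fst x). g p)"
      using finQ finite_wpart_member[OF P(1) S] by (intro prod.UNION_disjoint) (auto simp: restr_def)
    then show "(\<Prod>x\<in>Q. \<Prod>p\<in>(\<lambda>x\<in>Q. restr P (fst x)) x. g p) = (\<Prod>p\<in>P. g p)"
      unfolding union[OF P] by simp
  next
    fix \<phi> assume phi: "\<phi> \<in> PiE Q (below k)"
    show "(\<lambda>x\<in>Q. restr (\<Union>(\<phi> ` Q)) (fst x)) = \<phi>"
      using restr[OF phi] phi by (auto simp: fun_eq_iff PiE_def extensional_def)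
    show "\<Union>(\<phi> ` Q) \<in> {P. P \<in> wpart k S \<and> refines k P Q}"
      using glue[OF phi] restr[OF phi] PiE_mem[OF phi] by (simp add: refines_def)
  qed
  finally show ?thesis ..
qed

section \<open>The exponential formula\<close>

lemma sum_wpart_card_Suc:
  fixes g :: "nat set \<times> (nat \<Rightarrow>\<^sub>0 nat) \<Rightarrow> 'a::comm_semiring_1"
  assumes B: "finite B" and b: "b \<in> B"
  shows "(\<Sum>R | R \<in> wpart k B \<and> card R = Suc t. \<Prod>p\<in>R. g p) =
    (\<Sum>A\<in>Pow (B - {b}). (\<Sum>a\<in>WComp_in k (card A). g (insert b A, a)) *
       (\<Sum>R | R \<in> wpart k (B - insert b A) \<and> card R = t. \<Prod>p\<in>R. g p))"
proof -
  \<comment> \<open>The bijection removes the block containing \<open>b\<close>; in the triples of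
    \<open>?D\<close>, \<open>A\<close> is this block without \<open>b\<close>, so
    \<open>card A\<close> is the size of its weight.\<close>
  define blk where "blk R = (THE p. p \<in> R \<and> b \<in> fst p)" for R :: weighted_partition
  let ?D = "SIGMA A:Pow (B - {b}). WComp_in k (card A) \<times> {R. R \<in> wpart k (B - insert b A) \<and> card R = t}"
  have blk_eq: "blk R = p" if "R \<in> wpart k B" "p \<in> R" "b \<in> fst p" for R p
    unfolding blk_def using wpartD(4)[OF that(1)] that by blast
  have blk: "blk R \<in> R" "b \<in> fst (blk R)" if R: "R \<in> wpart k B" for R
  proof -
    obtain p where "p \<in> R" "b \<in> fst p" using wpartD(1)[OF R] b by blast
    then show "blk R \<in> R" "b \<in> fst (blk R)" using blk_eq[OF R] by auto
  qed
  have fin: "finite A" if "A \<subseteq> B - {b}" for A using that B by (meson finite_Diff finite_subset)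
  have new: "insert (insert b A, a) R \<in> wpart k B" "(insert b A, a) \<notin> R" "finite R"
    if A: "A \<subseteq> B - {b}" and a: "a \<in> WComp_in k (card A)" and R: "R \<in> wpart k (B - insert b A)" for A a R
  proof -
    have "card (insert b A) - 1 = card A" using A fin[OF A] by (subst card_insert_disjoint) auto
    moreover have "fst p \<inter> insert b A = {}" if "p \<in> R" for p using wpartD(1)[OF R] that by blast
    moreover have "\<Union> (fst ` insert (insert b A, a) R) = B"
      using wpartD(1)[OF R] A b by auto
    ultimately show "insert (insert b A, a) R \<in> wpart k B"
      using R a unfolding wpart_def by (auto simp: Int_commute)
    show "(insert b A, a) \<notin> R" using wpartD(1)[OF R] by force
    show "finite R" using finite_wpart_member[OF R] B by simp
  qed
  have "(\<Sum>A\<in>Pow (B - {b}). (\<Sum>a\<in>WComp_in k (card A). g (insert b A, a)) *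
       (\<Sum>R | R \<in> wpart k (B - insert b A) \<and> card R = t. \<Prod>p\<in>R. g p)) =
     (\<Sum>(A, a, R)\<in>?D. g (insert b A, a) * (\<Prod>p\<in>R. g p))"
    using B finite_wpart by (simp add: sum_product sum.cartesian_product sum.Sigma finite_WComp_in)
  also have "\<dots> = (\<Sum>R | R \<in> wpart k B \<and> card R = Suc t. \<Prod>p\<in>R. g p)"
  proof (rule sum.reindex_bij_witness[symmetric,
      where i = "\<lambda>(A, a, R). insert (insert b A, a) R"
        and j = "\<lambda>R. (fst (blk R) - {b}, snd (blk R), R - {blk R})"])
    fix R assume "R \<in> {R. R \<in> wpart k B \<and> card R = Suc t}"
    then have R: "R \<in> wpart k B" and card: "card R = Suc t" by simp_all
    have finR: "finite R" using finite_wpart_member[OF R B] .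
    have block: "(insert b (fst (blk R) - {b}), snd (blk R)) = blk R"
      using blk(2)[OF R] by (simp add: insert_absorb)
    show "(case (fst (blk R) - {b}, snd (blk R), R - {blk R}) of (A, a, R) \<Rightarrow> insert (insert b A, a) R) = R"
      using blk(1)[OF R] block by (simp add: insert_absorb)
    show "(case (fst (blk R) - {b}, snd (blk R), R - {blk R}) of (A, a, R) \<Rightarrow>
        g (insert b A, a) * (\<Prod>p\<in>R. g p)) = (\<Prod>p\<in>R. g p)"
      using prod.remove[OF finR blk(1)[OF R], of g] block by simp
    have sub: "fst (blk R) \<subseteq> B" using wpartD(1)[OF R] blk(1)[OF R] by blast
    have dis: "fst p \<inter> fst (blk R) = {}" if "p \<in> R - {blk R}" for p
      using wpartD(4)[OF R _ blk(1)[OF R]] that by blast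
    have "R = insert (blk R) (R - {blk R})" using blk(1)[OF R] by blast
    then have "\<Union> (fst ` R) = fst (blk R) \<union> \<Union> (fst ` (R - {blk R}))" by (metis Union_insert image_insert)
    then have "\<Union> (fst ` (R - {blk R})) = B - fst (blk R)"
      using wpartD(1)[OF R] dis by blast
    then have "R - {blk R} \<in> wpart k (B - fst (blk R))"
      using R unfolding wpart_def by blast
    moreover have "insert b (fst (blk R) - {b}) = fst (blk R)"
      using blk(2)[OF R] by blast
    moreover have "card (R - {blk R}) = t" using card blk(1)[OF R] by simp
    moreover have "card (fst (blk R) - {b}) = card (fst (blk R)) - 1"
      using blk(2)[OF R] by (simp add: card_Diff_singleton)
    ultimately show "(fst (blk R) - {b}, snd (blk R), R - {blk R}) \<in> ?D"
      using sub wpartD(3)[OF R blk(1)[OF R]] by auto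
  next
    fix u assume "u \<in> ?D"
    then obtain A a R where u: "u = (A, a, R)" and A: "A \<subseteq> B - {b}" and a: "a \<in> WComp_in k (card A)"
      and R: "R \<in> wpart k (B - insert b A)" and card: "card R = t"
      by auto
    note new = new[OF A a R]
    have "blk (insert (insert b A, a) R) = (insert b A, a)"
      by (rule blk_eq[OF new(1)]) simp_all
    moreover have "insert b A - {b} = A" using A by blast
    ultimately show "(fst (blk (case u of (A, a, R) \<Rightarrow> insert (insert b A, a) R)) - {b},
        snd (blk (case u of (A, a, R) \<Rightarrow> insert (insert b A, a) R)),
        (case u of (A, a, R) \<Rightarrow> insert (insert b A, a) R) -
          {blk (case u of (A, a, R) \<Rightarrow> insert (insert b A, a) R)}) = u"
      using new(2) by (simp add: u)
    show "(case u of (A, a, R) \<Rightarrow> insert (insert b A, a) R) \<in> {R. R \<in> wpart k B \<and> card R = Suc t}"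
      using new card by (simp add: u)
  qed
  finally show ?thesis ..
qed

lemma sum_Pow_card:
  fixes h :: "nat \<Rightarrow> 'a::comm_semiring_1"
  assumes "finite B"
  shows "(\<Sum>A\<in>Pow B. h (card A)) = (\<Sum>j\<le>card B. of_nat (card B choose j) * h j)"
proof -
  have "(\<Sum>A\<in>Pow B. h (card A)) = (\<Sum>j\<le>card B. \<Sum>A | A \<in> Pow B \<and> card A = j. h (card A))"
    using assms by (intro sum.group[symmetric]) (auto intro: card_mono)
  also have "\<dots> = (\<Sum>j\<le>card B. of_nat (card B choose j) * h j)"
  proof (rule sum.cong[OF refl])
    fix j
    have "(\<Sum>A | A \<in> Pow B \<and> card A = j. h (card A)) = (\<Sum>A | A \<subseteq> B \<and> card A = j. h j)"
      by (intro sum.cong) auto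
    then show "(\<Sum>A | A \<in> Pow B \<and> card A = j. h (card A)) = of_nat (card B choose j) * h j"
      using n_subsets[OF assms] by simp
  qed
  finally show ?thesis .
qed

lemma wpart_empty_iff: "{} \<in> wpart k B \<longleftrightarrow> B = {}"
  by (auto simp: wpart_def)

lemma wpart_empty: "wpart k {} = {{}}"
  by (fastforce simp: wpart_def)

text \<open>The exponential formula, by induction on the number of blocks: splitting off the block of a
  fixed element corresponds to \<open>(F ^ Suc t)' = Suc t * F' * F ^ t\<close>.\<close>

lemma exponential_formula:
  fixes F :: "'a::{comm_ring_1, semiring_char_0} fps"
  assumes g: "\<And>A. finite A \<Longrightarrow> A \<noteq> {} \<Longrightarrow>
      (\<Sum>a\<in>WComp_in k (card A - 1). g (A, a)) = fact (card A) * F $ card A"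
    and F: "F $ 0 = 0" and "finite B"
  shows "fact t * (\<Sum>R | R \<in> wpart k B \<and> card R = t. \<Prod>p\<in>R. g p) = fact (card B) * (F ^ t) $ card B"
  using \<open>finite B\<close>
proof (induction t arbitrary: B)
  case 0
  have "{R. R \<in> wpart k B \<and> card R = 0} = (if B = {} then {{}} else {})"
    using finite_wpart_member[OF _ 0] wpart_empty_iff[of k B] by auto
  then show ?case using 0 by simp
next
  case (Suc t)
  let ?T = "\<lambda>B t. \<Sum>R | R \<in> wpart k B \<and> card R = t. \<Prod>p\<in>R. g p"
  show ?case
  proof (cases "B = {}")
    case True
    have empty: "{R. R \<in> wpart k {} \<and> card R = Suc t} = {}" by (auto simp: wpart_empty)
    show ?thesis unfolding True empty using F by simp
  next
    case False
    then obtain b where b: "b \<in> B" by blast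
    define m where "m = card (B - {b})"
    have card: "card B = Suc m" using b Suc.prems card_gt_0_iff[of B] by (auto simp: m_def)
    let ?h = "\<lambda>j. fact (Suc j) * F $ Suc j * (fact (m - j) * (F ^ t) $ (m - j))"
    have "fact t * ?T B (Suc t) =
        (\<Sum>A\<in>Pow (B - {b}). (\<Sum>a\<in>WComp_in k (card A). g (insert b A, a)) * (fact t * ?T (B - insert b A) t))"
      unfolding sum_wpart_card_Suc[OF Suc.prems b] sum_distrib_left
      by (intro sum.cong) (simp_all add: algebra_simps sum_distrib_left)
    also have "\<dots> = (\<Sum>A\<in>Pow (B - {b}). ?h (card A))"
    proof (rule sum.cong[OF refl])
      fix A assume "A \<in> Pow (B - {b})"
      then have A: "A \<subseteq> B - {b}" by simp
      then have fin: "finite A" using Suc.prems by (meson finite_Diff finite_subset)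
      have bA: "b \<notin> A" using A by blast
      have "B - insert b A = (B - {b}) - A" by blast
      then have "card (B - insert b A) = m - card A"
        using card_Diff_subset[OF fin A] by (simp add: m_def)
      moreover have "finite (B - insert b A)" using Suc.prems by simp
      ultimately have "fact t * ?T (B - insert b A) t = fact (m - card A) * (F ^ t) $ (m - card A)"
        using Suc.IH[of "B - insert b A"] by simp
      moreover have "(\<Sum>a\<in>WComp_in k (card A). g (insert b A, a)) = fact (Suc (card A)) * F $ Suc (card A)"
        using g[of "insert b A"] fin bA by simp
      ultimately show "(\<Sum>a\<in>WComp_in k (card A). g (insert b A, a)) * (fact t * ?T (B - insert b A) t) =
          ?h (card A)"
        by simp
    qed
    also have "\<dots> = (\<Sum>j\<le>m. of_nat (m choose j) * ?h j)"
      unfolding m_def using Suc.prems by (intro sum_Pow_card) simp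
    \<comment> \<open>The binomial coefficient cancels the factorials up to a factor
      \<open>Suc j\<close>, which turns \<open>F $ Suc j\<close> into a coefficient of the
      derivative.\<close>
    also have "\<dots> = fact m * (\<Sum>j\<le>m. fps_deriv F $ j * (F ^ t) $ (m - j))"
      unfolding sum_distrib_left
    proof (rule sum.cong[OF refl])
      fix j assume "j \<in> {..m}"
      then have "(fact m :: 'a) = fact j * fact (m - j) * of_nat (m choose j)"
        using arg_cong[OF binomial_fact_lemma[of j m], of "of_nat :: nat \<Rightarrow> 'a"] by simp
      then show "of_nat (m choose j) * ?h j = fact m * (fps_deriv F $ j * (F ^ t) $ (m - j))"
        by (simp add: algebra_simps)
    qed
    also have "(\<Sum>j\<le>m. fps_deriv F $ j * (F ^ t) $ (m - j)) = (fps_deriv F * F ^ t) $ m"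
      by (simp add: fps_mult_nth atLeast0AtMost)
    finally have "fact (Suc t) * ?T B (Suc t) = fact m * (of_nat (Suc t) * (fps_deriv F * F ^ t) $ m)"
      by (simp add: mult.assoc mult.left_commute del: of_nat_Suc)
    also have "of_nat (Suc t) * (fps_deriv F * F ^ t) $ m = fps_deriv (F ^ Suc t) $ m"
      by (simp add: fps_deriv_power mult.assoc del: of_nat_Suc power_Suc fps_deriv_nth)
    also have "fact m * \<dots> = fact (card B) * (F ^ Suc t) $ card B"
      by (simp add: card algebra_simps del: power_Suc)
    finally show ?thesis .
  qed
qed

lemma card_wpart_le:
  assumes R: "R \<in> wpart k B" and B: "finite B"
  shows "card R \<le> card B"
proof -
  define e where "e p = (SOME i. i \<in> fst p)" for p :: "nat set \<times> (nat \<Rightarrow>\<^sub>0 nat)"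
  have e: "e p \<in> fst p" if "p \<in> R" for p
    unfolding e_def using wpartD(2)[OF R that] some_in_eq by blast
  have "inj_on e R"
  proof (rule inj_onI)
    fix p q assume "p \<in> R" "q \<in> R" "e p = e q"
    then show "p = q" using wpartD(4)[OF R] e by metis
  qed
  moreover have "e ` R \<subseteq> B" using e wpartD(1)[OF R] by blast
  ultimately show ?thesis using card_inj_on_le B by blast
qed


subsection \<open>The Moebius function\<close>

text \<open>Induction on the size of the interval. The values of \<open>f\<close> may lie in any
  ring, since the candidate used later is a product of rationals not yet known to be
  integers.\<close>

lemma moebius_eqI:
  fixes f :: "'a \<Rightarrow> 'b::ring_1"
  assumes r: "Partial_order r" "locally_finite r"
    and f: "\<And>y. (x, y) \<in> r \<Longrightarrow> (\<Sum>z | (x, z) \<in> r \<and> (z, y) \<in> r. f z) = (if x = y then 1 else 0)"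
    and "(x, y) \<in> r"
  shows "of_int (moebius r x y) = f y"
  using \<open>(x, y) \<in> r\<close>
proof (induction "card {z. (x, z) \<in> r \<and> (z, y) \<in> r}" arbitrary: y rule: less_induct)
  case less
  have tr: "trans r" "antisym r" and refl: "(y, y) \<in> r" "(x, x) \<in> r"
    using r less.prems by (auto simp: partial_order_on_def preorder_on_def refl_on_def Field_def)
  let ?I = "\<lambda>y. {z. (x, z) \<in> r \<and> (z, y) \<in> r}"
  have fin: "finite (?I y)" for y using r(2) by (simp add: locally_finite_def)
  show ?case
  proof (cases "x = y")
    case True
    have "?I y = {y}" using tr(2) refl True by (auto dest: antisymD)
    then have "f y = 1" using f[OF less.prems] True by simp
    moreover have "y \<in> Field r" using refl by (auto simp: Field_def)
    ultimately show ?thesis using moebius_refl[OF r] True by simp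
  next
    case False
    have I: "?I y = insert y {z. (x, z) \<in> r \<and> (z, y) \<in> r \<and> z \<noteq> y}"
      using less.prems refl by blast
    have "of_int (moebius r x z) = f z" if z: "(x, z) \<in> r" "(z, y) \<in> r" "z \<noteq> y" for z
    proof (rule less.hyps[OF psubset_card_mono[OF fin] z(1)])
      show "?I z \<subset> ?I y"
        using tr z less.prems refl by (auto dest: transD antisymD)
    qed
    then have "of_int (moebius r x y) = - (\<Sum>z | (x, z) \<in> r \<and> (z, y) \<in> r \<and> z \<noteq> y. f z)"
      unfolding moebius_less[OF r less.prems False] by simp
    also have "\<dots> = f y"
      using f[OF less.prems] False fin[of y] unfolding I
      by (simp add: eq_neg_iff_add_eq_0 neg_eq_iff_add_eq_0 add.commute)
    finally show ?thesis .
  qed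
qed

section \<open>The minimum of the poset\<close>

lemma Pi_bot_wpart: "Pi_bot n \<in> wpart k {1..n}"
  using Pi_bot_in by (simp add: weighted_partitions_eq_wpart)

text \<open>A block \<open>x\<close> contains \<open>card (fst x)\<close> singletons of weight 0, so
  \<open>snd x\<close> itself is the witness.\<close>

lemma Pi_bot_le:
  assumes Q: "Q \<in> wpart k {1..n}"
  shows "(Pi_bot n, Q) \<in> Pi_poset n k"
proof -
  have "restr (Pi_bot n) (fst x) \<in> below k x" if x: "x \<in> Q" for x
  proof -
    have "fst x \<subseteq> {1..n}" using wpartD(1)[OF Q] x by blast
    then have eq: "restr (Pi_bot n) (fst x) = (\<lambda>i. ({i}, 0)) ` fst x"
      by (auto simp: restr_def Pi_bot_def)
    have "restr (Pi_bot n) (fst x) \<in> wpart k (fst x)"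
      by (rule restr_wpart[OF Pi_bot_wpart]) (auto simp: eq)
    moreover have inj: "inj_on (\<lambda>i. ({i}, 0 :: nat \<Rightarrow>\<^sub>0 nat)) (fst x)"
      by (auto simp: inj_on_def)
    then have "snd x \<in> WComp_in k (card (restr (Pi_bot n) (fst x)) - 1)"
      unfolding eq using wpartD(3)[OF Q x] by (simp add: card_image)
    moreover have "(\<Sum>p\<in>restr (Pi_bot n) (fst x). snd p) = 0"
      unfolding eq by (simp add: sum.reindex inj)
    ultimately show ?thesis
      unfolding below_def by (intro CollectI conjI bexI[of _ "snd x"]) simp_all
  qed
  then show ?thesis
    using Q Pi_bot_wpart by (simp add: Pi_poset_iff refines_def)
qed

text \<open>The weight of a singleton has size 0, so the underlying set partition already determines
  the minimum.\<close>

lemma eq_Pi_bot_iff: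
  assumes Q: "Q \<in> wpart k {1..n}"
  shows "Pi_bot n = Q \<longleftrightarrow> (\<forall>x\<in>Q. card (fst x) = 1)"
proof
  assume *: "\<forall>x\<in>Q. card (fst x) = 1"
  have sing: "x = ({i}, 0)" if x: "x \<in> Q" "i \<in> fst x" for x i
  proof -
    have "fst x = {i}" using * x by (metis card_1_singletonE singletonD)
    moreover from this have "snd x = 0" using wpartD(3)[OF Q x(1)] by simp
    ultimately show ?thesis by (simp add: prod_eq_iff)
  qed
  show "Pi_bot n = Q"
  proof
    show "Pi_bot n \<subseteq> Q"
      unfolding Pi_bot_def using sing wpartD(1)[OF Q] by blast
    show "Q \<subseteq> Pi_bot n"
    proof
      fix x assume x: "x \<in> Q"
      then obtain i where i: "i \<in> fst x" using wpartD(2)[OF Q] by blast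
      then have "i \<in> {1..n}" using wpartD(1)[OF Q] x by blast
      then show "x \<in> Pi_bot n" using sing[OF x i] by (auto simp: Pi_bot_def)
    qed
  qed
qed (auto simp: Pi_bot_def)

section \<open>Coefficients of the inverse series and values of the Moebius function\<close>

definition hseries :: "nat \<Rightarrow> mpoly fps" where
  "hseries k = Abs_fps (\<lambda>n. if n = 0 then 0 else complete_homogeneous k (n - 1) * Const (1 / fact n))"

lemma hseries_0: "hseries k $ 0 = 0" and hseries_1: "hseries k $ 1 = 1"
  by (simp_all add: hseries_def)

lemma homogeneous_hseries: "homogeneous k (n - 1) (hseries k $ n)"
  using homogeneous_mult[OF homogeneous_complete_homogeneous homogeneous_Const]
  by (simp add: hseries_def)

text \<open>The coefficients of the compositional inverse, without the denominators \<open>n!\<close>; they turn out to be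
  the values of the Moebius function.\<close>

definition inv_coeff :: "nat \<Rightarrow> nat \<Rightarrow> (nat \<Rightarrow>\<^sub>0 nat) \<Rightarrow> rat" where
  "inv_coeff k n \<mu> = Poly_Mapping.lookup (fact n * comp_inv (hseries k) $ n) \<mu>"

lemma fact_comp_inv_hseries:
  "fact n * comp_inv (hseries k) $ n = (\<Sum>\<mu>\<in>WComp_in k (n - 1). Poly_Mapping.single \<mu> (inv_coeff k n \<mu>))"
proof -
  have "homogeneous k 0 (fact n)"
    by (metis homogeneous_Const Const_def of_nat_fact single_of_nat)
  then have "homogeneous k (n - 1) (fact n * comp_inv (hseries k) $ n)"
    using homogeneous_mult homogeneous_comp_inv[OF hseries_0 homogeneous_hseries] add_0 by metis
  then show ?thesis
    unfolding inv_coeff_def by (rule homogeneous_expand)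
qed

text \<open>Coefficient of \<open>x\<^sup>\<mu> y\<^sup>m / m!\<close> in \<open>hseries k oo comp_inv (hseries k) = fps_X\<close>.\<close>

lemma sum_below_inv_coeff:
  assumes B: "finite B" "B \<noteq> {}" and mu: "\<mu> \<in> WComp_in k (card B - 1)"
  shows "(\<Sum>R\<in>below k (B, \<mu>). \<Prod>p\<in>R. inv_coeff k (card (fst p)) (snd p)) = (if card B = 1 then 1 else 0)"
proof -
  let ?H = "hseries k" and ?G = "comp_inv (hseries k)" and ?m = "card B"
  define v where "v R = (\<Prod>p\<in>R. inv_coeff k (card (fst p)) (snd p))" for R :: weighted_partition
  \<comment> \<open>Attaching the monomial of the weight lets multiplication of monomials add up the
    weights of the blocks.\<close>
  define g where "g p = Poly_Mapping.single (snd p) (inv_coeff k (card (fst p)) (snd p))"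
    for p :: "nat set \<times> (nat \<Rightarrow>\<^sub>0 nat)"
  have g: "(\<Prod>p\<in>R. g p) = Poly_Mapping.single (\<Sum>p\<in>R. snd p) (v R)" if "finite R" for R
    using that unfolding v_def g_def by (induction R) (simp_all add: mult_single)
  have expf: "fact t * (\<Sum>R | R \<in> wpart k B \<and> card R = t. \<Prod>p\<in>R. g p) = fact ?m * (?G ^ t) $ ?m" for t
    by (rule exponential_formula[OF _ comp_inv_0 B(1)]) (simp add: g_def fact_comp_inv_hseries)
  \<comment> \<open>Grouped by number of blocks, the exponential formula turns \<open>E\<close> into
    \<open>fact ?m\<close> times the coefficient of \<open>?H oo ?G\<close>.\<close>
  define E where "E = (\<Sum>R\<in>wpart k B. ?H $ card R * (fact (card R) * (\<Prod>p\<in>R. g p)))"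
  have "E = (\<Sum>t\<le>?m. \<Sum>R | R \<in> wpart k B \<and> card R = t. ?H $ card R * (fact (card R) * (\<Prod>p\<in>R. g p)))"
    unfolding E_def using card_wpart_le B finite_wpart by (intro sum.group[symmetric]) auto
  also have "\<dots> = (\<Sum>t\<le>?m. ?H $ t * (fact t * (\<Sum>R | R \<in> wpart k B \<and> card R = t. \<Prod>p\<in>R. g p)))"
    by (simp add: sum_distrib_left)
  also have "\<dots> = fact ?m * (?H oo ?G) $ ?m"
    unfolding expf by (simp add: fps_compose_nth sum_distrib_left atLeast0AtMost mult.left_commute)
  also have "\<dots> = fact ?m * fps_X $ ?m"
    by (simp add: compose_comp_inv[OF hseries_0 hseries_1])
  \<comment> \<open>For \<open>?m = 1\<close> the only possible \<mu> is 0, where the constant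
    polynomial 1 has coefficient 1.\<close>
  finally have E: "Poly_Mapping.lookup E \<mu> = (if ?m = 1 then 1 else 0)"
    using mu by (cases "?m = 1") simp_all
  \<comment> \<open>The factorial cancels the denominator in \<open>hseries\<close>, leaving each
    monomial \<nu> of degree \<open>card R - 1\<close> once. By cancellation at most one \<nu>
    completes the weight of \<open>R\<close> to \<mu>, and one exists exactly when \<open>R\<close>
    lies in \<open>below k (B, \<mu>)\<close>.\<close>
  have R: "Poly_Mapping.lookup (?H $ card R * (fact (card R) * (\<Prod>p\<in>R. g p))) \<mu> =
      (if R \<in> below k (B, \<mu>) then v R else 0)" if R: "R \<in> wpart k B" for R
  proof -
    have finR: "finite R" using finite_wpart_member[OF R B(1)] .
    have "R \<noteq> {}" using R B wpart_empty_iff by blast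
    then have "?H $ card R * fact (card R) =
        complete_homogeneous k (card R - 1) * (fact (card R) * Const (1 / fact (card R)))"
      using finR by (simp add: hseries_def mult_ac)
    also have "\<dots> = complete_homogeneous k (card R - 1)"
      unfolding fact_times_Const by simp
    finally have "?H $ card R * (fact (card R) * (\<Prod>p\<in>R. g p)) =
        (\<Sum>\<nu>\<in>WComp_in k (card R - 1). Poly_Mapping.single (\<nu> + (\<Sum>p\<in>R. snd p)) (v R))"
      by (simp add: mult.assoc[symmetric] g[OF finR] complete_homogeneous_eq sum_distrib_right mult_single)
    then have eq: "Poly_Mapping.lookup (?H $ card R * (fact (card R) * (\<Prod>p\<in>R. g p))) \<mu> =
        (\<Sum>\<nu>\<in>WComp_in k (card R - 1). v R when \<nu> + (\<Sum>p\<in>R. snd p) = \<mu>)"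
      by (simp add: lookup_sum lookup_single)
    show ?thesis
    proof (cases "R \<in> below k (B, \<mu>)")
      case True
      then obtain \<nu> where nu: "\<nu> \<in> WComp_in k (card R - 1)" "\<mu> = (\<Sum>p\<in>R. snd p) + \<nu>"
        by (auto simp: below_def)
      then have "\<nu>' + (\<Sum>p\<in>R. snd p) = \<mu> \<longleftrightarrow> \<nu>' = \<nu>" for \<nu>'
        by (simp add: add.commute)
      then show ?thesis
        using True nu(1) by (simp add: eq when_def finite_WComp_in)
    next
      case False
      then show ?thesis
        using R unfolding eq below_def by (auto simp: when_def add.commute intro!: sum.neutral)
    qed
  qed
  have "(\<Sum>R\<in>below k (B, \<mu>). v R) = (\<Sum>R\<in>wpart k B. if R \<in> below k (B, \<mu>) then v R else 0)"
    using finite_wpart[OF B(1)] by (intro sum.mono_neutral_cong_left) (auto simp: below_def)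
  also have "\<dots> = Poly_Mapping.lookup E \<mu>"
    unfolding E_def lookup_sum using R by (intro sum.cong) simp_all
  finally show ?thesis
    using E by (simp add: v_def)
qed

lemma moebius_Pi_poset:
  assumes Q: "Q \<in> wpart k {1..n}"
  shows "of_int (moebius (Pi_poset n k) (Pi_bot n) Q) = (\<Prod>x\<in>Q. inv_coeff k (card (fst x)) (snd x))"
proof (rule moebius_eqI[OF Partial_order_Pi_poset locally_finite_Pi_poset _ Pi_bot_le[OF Q]])
  let ?f = "\<lambda>P. \<Prod>x\<in>P. inv_coeff k (card (fst x)) (snd x)"
  fix Q assume "(Pi_bot n, Q) \<in> Pi_poset n k"
  then have Q: "Q \<in> wpart k {1..n}" by (simp add: Pi_poset_iff)
  have finQ: "finite Q" using finite_wpart_member[OF Q] by simp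
  have "(\<Sum>P | (Pi_bot n, P) \<in> Pi_poset n k \<and> (P, Q) \<in> Pi_poset n k. ?f P) =
      (\<Sum>P | P \<in> wpart k {1..n} \<and> refines k P Q. ?f P)"
    using Q Pi_bot_le by (intro sum.cong) (auto simp: Pi_poset_iff[of _ Q])
  also have "\<dots> = (\<Prod>x\<in>Q. \<Sum>R\<in>below k x. ?f R)"
    using Q by (rule sum_prod_refines) simp
  also have "\<dots> = (\<Prod>x\<in>Q. if card (fst x) = 1 then 1 else 0)"
  proof (rule prod.cong[OF refl])
    fix x assume x: "x \<in> Q"
    have "finite (fst x)" using wpartD(1)[OF Q] x by (auto intro: finite_subset)
    then show "(\<Sum>R\<in>below k x. ?f R) = (if card (fst x) = 1 then 1 else 0)"
      using sum_below_inv_coeff[of "fst x" "snd x" k] wpartD(2,3)[OF Q x] by simp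
  qed
  \<comment> \<open>One non-singleton block makes the product vanish; without one, \<open>Q\<close>
    is the minimum.\<close>
  also have "\<dots> = (if Pi_bot n = Q then 1 else 0)"
    unfolding eq_Pi_bot_iff[OF Q] using finQ by (auto intro: prod_zero)
  finally show "(\<Sum>P | (Pi_bot n, P) \<in> Pi_poset n k \<and> (P, Q) \<in> Pi_poset n k. ?f P) =
      (if Pi_bot n = Q then 1 else 0)" .
qed

theorem theorem3p2:
  fixes k :: nat
  assumes "k \<ge> 1"
  shows "is_compositional_inverse
    (Abs_fps (\<lambda>n. if n = 0 then 0 else
       (\<Sum>\<mu>\<in>{\<mu> \<in> WComp (n - 1). Poly_Mapping.keys \<mu> \<subseteq> {1..k}}.
          of_int (moebius (Pi_poset n k) (Pi_bot n) (one_block n \<mu>)) * xpow k \<mu> * Const (1 / fact n))))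
    (Abs_fps (\<lambda>n. if n = 0 then 0 else complete_homogeneous k (n - 1) * Const (1 / fact n)))"
    (is "is_compositional_inverse ?M ?H")
proof -
  have "?M $ n = comp_inv (hseries k) $ n" for n
  proof (cases "n = 0")
    case False
    \<comment> \<open>For a one-block partition the product formula for the Moebius function has a
      single factor.\<close>
    have summand: "of_int (moebius (Pi_poset n k) (Pi_bot n) (one_block n \<mu>)) * xpow k \<mu> =
        Poly_Mapping.single \<mu> (inv_coeff k n \<mu>)" if mu: "\<mu> \<in> WComp_in k (n - 1)" for \<mu>
    proof -
      let ?z = "moebius (Pi_poset n k) (Pi_bot n) (one_block n \<mu>)"
      have "one_block n \<mu> \<in> wpart k {1..n}"
        using one_block_in[OF _ mu] False by (simp add: weighted_partitions_eq_wpart)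
      from moebius_Pi_poset[OF this] have "of_int ?z = inv_coeff k n \<mu>"
        by (simp add: one_block_def)
      then show ?thesis
        using single_of_int[of ?z, where ?'a = "nat \<Rightarrow>\<^sub>0 nat" and ?'b = rat]
        by (metis xpow_eq_single[OF mu] mult_single add_0 mult_1_right)
    qed
    have "?M $ n = (\<Sum>\<mu>\<in>WComp_in k (n - 1). Poly_Mapping.single \<mu> (inv_coeff k n \<mu>)) * Const (1 / fact n)"
      unfolding WComp_in_def[symmetric] using False summand by (simp add: sum_distrib_right)
    also have "\<dots> = (fact n * Const (1 / fact n)) * comp_inv (hseries k) $ n"
      by (simp only: fact_comp_inv_hseries[symmetric] mult_ac)
    finally show ?thesis
      by (simp add: fact_times_Const)
  qed (simp add: comp_inv_0)
  then have "?M = comp_inv (hseries k)"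
    by (rule fps_ext)
  then show ?thesis
    unfolding is_compositional_inverse_def hseries_def[symmetric]
    using hseries_0 comp_inv_0 compose_comp_inv[OF hseries_0 hseries_1] comp_inv_compose[OF hseries_0 hseries_1]
    by metis
qed

end
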